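(* Consider the problem (PC) of the context. Let $f(\cdot,t):\mathbb{R}^n\to\mathbb{R}$ be continuously differentiable and convex with respect to $x$, and let $W_k$ ($k\in I$) and $q$ be continuous convex functions. Then, for optimality of the feasible arc $\tilde x(t)$, $t\in[0,1]$, in the convex problem (PC) it is sufficient that there exist a pair of absolutely continuous functions $\{x^*(t),\psi^*(t)\}$, $t\in[0,1]$ (of the class described in the context), and functions $\alpha_k(t)\ge0$, $k\in I(\tilde x(t),\tilde x'(t),\tilde x''(t))$, such that (i) for a.e. $t\in[0,1]$, $$\Bigl(\frac{d^2x^*(t)}{dt^2}+\frac{d\psi^*(t)}{dt}-f_x'(\tilde x(t),t),\ \psi^*(t),\ -x^*(t)\Bigr)\in\sum_{k\in I(\tilde x(t),\tilde x'(t),\tilde x''(t))}\alpha_k(t)\,\partial_{(x,v_1,v_2)}W_k(\tilde x(t),\tilde x'(t),\tilde x''(t));$$ (ii) $\alpha_k(t)W_k(\tilde x(t),\tilde x'(t),\tilde x''(t))=0$, $\alpha_k(t)\ge0$, a.e. $t\in[0,1]$; (iii) $-\psi^*(1)-\dfrac{dx^*(1)}{dt}\in\partial q(\tilde x(1))$, $\ x^*(1)=0$.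
   Context: Problem (PC): minimize $J[x(\cdot)]=\int_0^1f(x(t),t)\,dt+q(x(1))$ subject to $W_k(x(t),x'(t),x''(t))\le0$ for a.e. $t\in[0,1]$, $k\in I=\{1,\dots,m\}$, and $x(0)=\upsilon_0$, $x'(0)=\upsilon_1$, where $\upsilon_0,\upsilon_1\in\mathbb{R}^n$ are fixed, $W_k:\mathbb{R}^{3n}\to\mathbb{R}$ and $q:\mathbb{R}^n\to\mathbb{R}$. A feasible trajectory (arc) $x(\cdot):[0,1]\to\mathbb{R}^n$ is an absolutely continuous, twice differentiable function with $x''(\cdot)\in L_1^n([0,1])$ satisfying the constraints; it is optimal if it minimizes $J$ among feasible trajectories. Class of adjoint functions: $x^*(t)$ is absolutely continuous and twice differentiable on $[0,1]$ with $x^{*\prime\prime}(\cdot)\in L_1^n([0,1])$; $\psi^*(t)$ is absolutely continuous with $\psi^{*\prime}(\cdot)\in L_1^n([0,1])$. $I(x,v_1,v_2)=\{k\in I:W_k(x,v_1,v_2)=0\}$; $\partial$ is the convex subdifferential, $\partial_{(x,v_1,v_2)}W_k$ being taken in all arguments; an empty sum of sets is $\{0\}$. *)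

theory Defs
  imports "HOL-Analysis.Analysis" "HOL-Library.Set_Algebras"
begin

text \<open>
  The usual epsilon-delta notion, for functions on a subset of the real line: the finite families of
  nonoverlapping intervals are the divisions in the sense of the library, and an interval \<open>K\<close> of
  such a family has the end points \<open>Inf K\<close> and \<open>Sup K\<close>.
\<close>

definition abs_continuous_on :: "real set \<Rightarrow> (real \<Rightarrow> 'a::real_normed_vector) \<Rightarrow> bool" where
  "abs_continuous_on S x \<longleftrightarrow>
     (\<forall>\<epsilon>>0. \<exists>\<delta>>0. \<forall>\<D> T. \<D> division_of T \<and> T \<subseteq> S \<and> (\<Sum>K\<in>\<D>. Sup K - Inf K) < \<delta> \<longrightarrow>
        (\<Sum>K\<in>\<D>. norm (x (Sup K) - x (Inf K))) < \<epsilon>)"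

text \<open>
  Time derivative on \<open>[0,1]\<close>, one-sided at the end points. The value is meaningful only where \<open>x\<close>
  is differentiable within \<open>[0,1]\<close>.
\<close>

definition ddt :: "(real \<Rightarrow> 'a::real_normed_vector) \<Rightarrow> real \<Rightarrow> 'a" where
  "ddt x t = vector_derivative x (at t within {0..1})"

definition ac_arc :: "(real \<Rightarrow> 'a::euclidean_space) \<Rightarrow> bool" where
  "ac_arc x \<longleftrightarrow>
     abs_continuous_on {0..1} x \<and>
     (AE t\<in>{0..1} in lebesgue. x differentiable (at t within {0..1})) \<and>
     ddt x absolutely_integrable_on {0..1}"

text \<open>
  Absolutely continuous, twice differentiable functions with integrable second derivative: the
  Sobolev class $W^{2,1}$. The first derivative exists everywhere and is absolutely continuous; the
  second derivative exists almost everywhere. Functions that are twice differentiable at every point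
  of \<open>[0,1]\<close> and have an integrable second derivative belong to this class, because an everywhere
  existing integrable derivative makes its primitive absolutely continuous.
\<close>

definition ac2_arc :: "(real \<Rightarrow> 'a::euclidean_space) \<Rightarrow> bool" where
  "ac2_arc x \<longleftrightarrow>
     abs_continuous_on {0..1} x \<and>
     (\<forall>t\<in>{0..1}. x differentiable (at t within {0..1})) \<and>
     ac_arc (ddt x)"

definition subdifferential :: "('a::real_inner \<Rightarrow> real) \<Rightarrow> 'a \<Rightarrow> 'a set" where
  "subdifferential g z = {\<xi>. \<forall>y. g y \<ge> g z + \<xi> \<bullet> (y - z)}"

text \<open>
  A constraint function on $R^{3n}$ is a function of the triple \<open>(x, v\<^sub>1, v\<^sub>2)\<close>; the inner product
  of triples is the Euclidean one.
\<close>

definition active_set ::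
    "(nat \<Rightarrow> (real^'n) \<times> (real^'n) \<times> (real^'n) \<Rightarrow> real) \<Rightarrow> nat \<Rightarrow>
     (real^'n) \<times> (real^'n) \<times> (real^'n) \<Rightarrow> nat set" where
  "active_set W m z = {k \<in> {1..m}. W k z = 0}"

definition feasible_arc ::
    "(nat \<Rightarrow> (real^'n) \<times> (real^'n) \<times> (real^'n) \<Rightarrow> real) \<Rightarrow> nat \<Rightarrow> real^'n \<Rightarrow> real^'n \<Rightarrow>
     (real \<Rightarrow> real^'n) \<Rightarrow> bool" where
  "feasible_arc W m \<upsilon>0 \<upsilon>1 x \<longleftrightarrow>
     ac2_arc x \<and>
     (AE t\<in>{0..1} in lebesgue. \<forall>k\<in>{1..m}. W k (x t, ddt x t, ddt (ddt x) t) \<le> 0) \<and>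
     x 0 = \<upsilon>0 \<and> ddt x 0 = \<upsilon>1"

text \<open>
  The integral is a Lebesgue integral, and is 0 by convention if \<open>t \<mapsto> f (x t) t\<close> is not integrable; the
  functional is therefore meaningful only along arcs for which this integrand is integrable.
\<close>

definition objective ::
    "(real^'n \<Rightarrow> real \<Rightarrow> real) \<Rightarrow> (real^'n \<Rightarrow> real) \<Rightarrow> (real \<Rightarrow> real^'n) \<Rightarrow> real" where
  "objective f q x = (LINT t:{0..1}|lebesgue. f (x t) t) + q (x 1)"

definition optimal_arc ::
    "(real^'n \<Rightarrow> real \<Rightarrow> real) \<Rightarrow> (real^'n \<Rightarrow> real) \<Rightarrow>
     (nat \<Rightarrow> (real^'n) \<times> (real^'n) \<times> (real^'n) \<Rightarrow> real) \<Rightarrow> nat \<Rightarrow> real^'n \<Rightarrow> real^'n \<Rightarrow>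
     (real \<Rightarrow> real^'n) \<Rightarrow> bool" where
  "optimal_arc f q W m \<upsilon>0 \<upsilon>1 x \<longleftrightarrow>
     feasible_arc W m \<upsilon>0 \<upsilon>1 x \<and> (\<forall>y. feasible_arc W m \<upsilon>0 \<upsilon>1 y \<longrightarrow> objective f q x \<le> objective f q y)"

end

theory Submission
  imports Defs
begin

text \<open>
  Let \<open>y\<close> be a competing feasible arc, and write \<open>p\<close> and \<open>\<psi>\<close> for the adjoint functions. At almost
  every time, pairing the adjoint inclusion with the difference of the triples \<open>(y, y', y'')\<close> and
  \<open>(x, x', x'')\<close> gives a nonpositive number: each subgradient of an active constraint is at most
  \<open>W\<^sub>k(y, y', y'') - W\<^sub>k(x, x', x'') \<le> 0\<close> on this difference, and the multipliers are nonnegative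
  (\<open>weighted_subgradients_inner_le_0\<close>). With the gradient inequality for \<open>f\<close> this becomes
  \<open>(p'' + \<psi>') \<bullet> (y - x) + \<psi> \<bullet> (y' - x') - p \<bullet> (y'' - x'') \<le> f(y, t) - f(x, t)\<close>.

  The left-hand side is the derivative of \<open>p' \<bullet> (y - x) - p \<bullet> (y' - x') + \<psi> \<bullet> (y - x)\<close>, so its
  integral is a difference of boundary values (\<open>green_formula\<close>). The values at \<open>0\<close> vanish because
  both arcs satisfy the same initial conditions; as \<open>p 1 = 0\<close>, what remains is
  \<open>(p' 1 + \<psi> 1) \<bullet> (y 1 - x 1)\<close>. The terminal condition says that the negative of this quantity is
  at most \<open>q (y 1) - q (x 1)\<close>, and adding the two inequalities shows that \<open>x\<close> costs no more
  than \<open>y\<close>.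

  The analytic ingredient is the fundamental theorem of calculus for absolutely continuous functions
  (\<open>fundamental_theorem_of_calculus_abs_continuous\<close>), called for because the second derivatives exist
  only almost everywhere. It is proved directly for the gauge integral, where the existence of the
  integral is part of the conclusion; products such as \<open>p'' \<bullet> y\<close> are therefore only ever integrated
  together, as the derivative of an absolutely continuous function.
\<close>

section \<open>Absolutely continuous functions\<close>

lemma abs_continuous_onE:
  assumes "abs_continuous_on S x" "\<epsilon> > 0"
  obtains \<delta> where "\<delta> > 0"
    "\<And>\<D> T. \<D> division_of T \<Longrightarrow> T \<subseteq> S \<Longrightarrow> (\<Sum>K\<in>\<D>. Sup K - Inf K) < \<delta> \<Longrightarrow>
        (\<Sum>K\<in>\<D>. norm (x (Sup K) - x (Inf K))) < \<epsilon>"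
proof -
  have "\<exists>\<delta>>0. \<forall>\<D> T. \<D> division_of T \<and> T \<subseteq> S \<and> (\<Sum>K\<in>\<D>. Sup K - Inf K) < \<delta> \<longrightarrow>
        (\<Sum>K\<in>\<D>. norm (x (Sup K) - x (Inf K))) < \<epsilon>"
    using assms unfolding abs_continuous_on_def by simp
  then show thesis
    by (elim exE conjE) (rule that, assumption, blast)
qed

text \<open>
  Sums, differences and products of absolutely continuous functions all inherit their modulus of
  absolute continuity from an increment estimate of this form.
\<close>

lemma abs_continuous_on_dominated:
  assumes u: "abs_continuous_on S u" and v: "abs_continuous_on S v"
    and le: "\<And>s t. s \<in> S \<Longrightarrow> t \<in> S \<Longrightarrow> norm (w s - w t) \<le> M * (norm (u s - u t) + norm (v s - v t))"
  shows "abs_continuous_on S w"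
  unfolding abs_continuous_on_def
proof (intro allI impI)
  fix \<epsilon> :: real assume "\<epsilon> > 0"
  \<comment> \<open>\<open>M\<close> may be zero or negative, and \<open>\<epsilon>\<close> is to be divided by the factor.\<close>
  define C where "C = max M 1"
  have C: "C > 0" "M \<le> C" by (auto simp: C_def)
  define \<eta> where "\<eta> = \<epsilon> / (2 * C)"
  have \<eta>: "\<eta> > 0" "C * (\<eta> + \<eta>) = \<epsilon>"
    using \<open>\<epsilon> > 0\<close> C by (auto simp: \<eta>_def field_simps)
  obtain \<delta>1 where \<delta>1: "\<delta>1 > 0"
    "\<And>\<D> T. \<D> division_of T \<Longrightarrow> T \<subseteq> S \<Longrightarrow> (\<Sum>K\<in>\<D>. Sup K - Inf K) < \<delta>1 \<Longrightarrow>
        (\<Sum>K\<in>\<D>. norm (u (Sup K) - u (Inf K))) < \<eta>"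
    using abs_continuous_onE[OF u \<eta>(1)] by metis
  obtain \<delta>2 where \<delta>2: "\<delta>2 > 0"
    "\<And>\<D> T. \<D> division_of T \<Longrightarrow> T \<subseteq> S \<Longrightarrow> (\<Sum>K\<in>\<D>. Sup K - Inf K) < \<delta>2 \<Longrightarrow>
        (\<Sum>K\<in>\<D>. norm (v (Sup K) - v (Inf K))) < \<eta>"
    using abs_continuous_onE[OF v \<eta>(1)] by metis
  show "\<exists>\<delta>>0. \<forall>\<D> T. \<D> division_of T \<and> T \<subseteq> S \<and> (\<Sum>K\<in>\<D>. Sup K - Inf K) < \<delta> \<longrightarrow>
          (\<Sum>K\<in>\<D>. norm (w (Sup K) - w (Inf K))) < \<epsilon>"
  proof (intro exI[of _ "min \<delta>1 \<delta>2"] conjI allI impI)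
    fix \<D> T
    assume \<D>: "\<D> division_of T \<and> T \<subseteq> S \<and> (\<Sum>K\<in>\<D>. Sup K - Inf K) < min \<delta>1 \<delta>2"
    have "(\<Sum>K\<in>\<D>. norm (w (Sup K) - w (Inf K)))
        \<le> (\<Sum>K\<in>\<D>. C * (norm (u (Sup K) - u (Inf K)) + norm (v (Sup K) - v (Inf K))))"
    proof (rule sum_mono)
      fix K assume K: "K \<in> \<D>"
      then obtain a b where ab: "K = {a..b}" "K \<noteq> {}" "K \<subseteq> T"
        using \<D> by (metis box_real(2) division_ofD(2,3,4))
      then have "Sup K \<in> S" "Inf K \<in> S"
        using \<D> by auto
      then have "norm (w (Sup K) - w (Inf K))
          \<le> M * (norm (u (Sup K) - u (Inf K)) + norm (v (Sup K) - v (Inf K)))"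
        by (rule le)
      also have "\<dots> \<le> C * (norm (u (Sup K) - u (Inf K)) + norm (v (Sup K) - v (Inf K)))"
        using C by (intro mult_right_mono) auto
      finally show "norm (w (Sup K) - w (Inf K)) \<le> \<dots>" .
    qed
    also have "\<dots> = C * ((\<Sum>K\<in>\<D>. norm (u (Sup K) - u (Inf K))) + (\<Sum>K\<in>\<D>. norm (v (Sup K) - v (Inf K))))"
      by (simp add: sum.distrib flip: sum_distrib_left)
    also have "\<dots> < C * (\<eta> + \<eta>)"
      using \<delta>1(2)[of \<D> T] \<delta>2(2)[of \<D> T] \<D> C by (intro mult_strict_left_mono) auto
    finally show "(\<Sum>K\<in>\<D>. norm (w (Sup K) - w (Inf K))) < \<epsilon>"
      using \<eta>(2) by simp
  qed (use \<delta>1 \<delta>2 in auto)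
qed

lemma abs_continuous_on_add:
  assumes "abs_continuous_on S u" "abs_continuous_on S v"
  shows "abs_continuous_on S (\<lambda>t. u t + v t)"
  by (rule abs_continuous_on_dominated[OF assms, where M = 1])
    (simp add: add_diff_add norm_triangle_ineq)

lemma abs_continuous_on_diff:
  assumes "abs_continuous_on S u" "abs_continuous_on S v"
  shows "abs_continuous_on S (\<lambda>t. u t - v t)"
proof (rule abs_continuous_on_dominated[OF assms, where M = 1])
  fix s t
  show "norm (u s - v s - (u t - v t)) \<le> 1 * (norm (u s - u t) + norm (v s - v t))"
    using norm_triangle_ineq4[of "u s - u t" "v s - v t"] by (simp add: algebra_simps)
qed

lemma abs_continuous_on_imp_continuous_on:
  assumes u: "abs_continuous_on {a..b} u"
  shows "continuous_on {a..b} u"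
  unfolding continuous_on_iff
proof (intro ballI allI impI)
  fix s \<epsilon> :: real
  assume s: "s \<in> {a..b}" and "\<epsilon> > 0"
  obtain \<delta> where \<delta>: "\<delta> > 0"
    "\<And>\<D> T. \<D> division_of T \<Longrightarrow> T \<subseteq> {a..b} \<Longrightarrow> (\<Sum>K\<in>\<D>. Sup K - Inf K) < \<delta> \<Longrightarrow>
        (\<Sum>K\<in>\<D>. norm (u (Sup K) - u (Inf K))) < \<epsilon>"
    using abs_continuous_onE[OF u \<open>\<epsilon> > 0\<close>] by metis
  have small: "norm (u d - u c) < \<epsilon>" if "a \<le> c" "c \<le> d" "d \<le> b" "d - c < \<delta>" for c d
    using \<delta>(2)[of "{{c..d}}" "{c..d}"] division_of_self[of c d] that by auto
  show "\<exists>d>0. \<forall>t\<in>{a..b}. dist t s < d \<longrightarrow> dist (u t) (u s) < \<epsilon>"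
  proof (intro exI[of _ \<delta>] conjI ballI impI)
    fix t assume "t \<in> {a..b}" "dist t s < \<delta>"
    then show "dist (u t) (u s) < \<epsilon>"
      using small[of s t] small[of t s] s
      by (cases "s \<le> t") (auto simp: dist_norm norm_minus_commute)
  qed (use \<delta> in auto)
qed

text \<open>
  Both factors are bounded, being continuous on a compact interval, so the increment of the product
  is controlled by the increments of the factors.
\<close>

lemma abs_continuous_on_inner:
  fixes u v :: "real \<Rightarrow> 'a::real_inner"
  assumes u: "abs_continuous_on {a..b} u" and v: "abs_continuous_on {a..b} v"
  shows "abs_continuous_on {a..b} (\<lambda>t. u t \<bullet> v t)"
proof -
  have "\<exists>B\<ge>0. \<forall>t\<in>{a..b}. norm (w t) \<le> B"
    if "abs_continuous_on {a..b} w" for w :: "real \<Rightarrow> 'a"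
  proof -
    have "bounded (w ` {a..b})"
      using that abs_continuous_on_imp_continuous_on compact_Icc
        compact_continuous_image compact_imp_bounded by blast
    then show ?thesis
      unfolding bounded_pos by (meson imageI less_imp_le)
  qed
  then obtain A B where A: "A \<ge> 0" "\<And>t. t \<in> {a..b} \<Longrightarrow> norm (u t) \<le> A"
    and B: "B \<ge> 0" "\<And>t. t \<in> {a..b} \<Longrightarrow> norm (v t) \<le> B"
    using u v by metis
  show ?thesis
  proof (rule abs_continuous_on_dominated[OF u v])
    fix s t assume st: "s \<in> {a..b}" "t \<in> {a..b}"
    have "u s \<bullet> v s - u t \<bullet> v t = (u s - u t) \<bullet> v s + u t \<bullet> (v s - v t)"
      by (simp add: inner_diff_left inner_diff_right)
    also have "norm \<dots> \<le> norm (u s - u t) * norm (v s) + norm (u t) * norm (v s - v t)"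
      by (rule norm_triangle_mono) (auto simp: Cauchy_Schwarz_ineq2)
    also have "\<dots> \<le> norm (u s - u t) * (A + B) + (A + B) * norm (v s - v t)"
      using A(1) B(1) A(2)[OF st(2)] B(2)[OF st(1)]
      by (intro add_mono mult_left_mono mult_right_mono) auto
    finally show "norm (u s \<bullet> v s - u t \<bullet> v t) \<le> (A + B) * (norm (u s - u t) + norm (v s - v t))"
      by (simp add: algebra_simps)
  qed
qed

text \<open>
  Lebesgue's form of the fundamental theorem of calculus, obtained from one choice of gauge. Off the
  exceptional set \<open>N\<close> the gauge comes from differentiability, as for an everywhere differentiable
  function. On \<open>N\<close> it forces every interval with tag in \<open>N\<close> into an open set of small measure, so that
  absolute continuity makes the increments of \<open>F\<close> over these intervals small in total.
\<close>

theorem fundamental_theorem_of_calculus_abs_continuous: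
  fixes F g :: "real \<Rightarrow> 'a::real_normed_vector"
  assumes "a \<le> b" and F: "abs_continuous_on {a..b} F" and N: "negligible N"
    and deriv: "\<And>t. t \<in> {a..b} - N \<Longrightarrow> (F has_vector_derivative g t) (at t within {a..b})"
  shows "(g has_integral (F b - F a)) {a..b}"
proof -
  define g0 where "g0 t = (if t \<in> N then 0 else g t)" for t
  have "(g0 has_integral (F b - F a)) (cbox a b)"
    unfolding has_integral
  proof (intro allI impI)
    fix e :: real assume "e > 0"
    \<comment> \<open>The summand \<open>1\<close> keeps the denominator positive if \<open>a = b\<close>.\<close>
    define e' where "e' = e / (2 * (b - a + 1))"
    have e': "e' > 0" "e' * (b - a) < e / 2"
      using \<open>e > 0\<close> \<open>a \<le> b\<close> by (auto simp: e'_def field_simps)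
    have "\<forall>x. \<exists>d>0. x \<in> {a..b} - N \<longrightarrow>
        (\<forall>y\<in>{a..b}. norm (y - x) < d \<longrightarrow> norm (F y - F x - (y - x) *\<^sub>R g x) \<le> e' * norm (y - x))"
      using deriv[unfolded has_vector_derivative_def has_derivative_within_alt] e'(1)
      by (metis zero_less_one)
    then obtain d where d: "\<And>x. 0 < d x"
      "\<And>x y. \<lbrakk>x \<in> {a..b} - N; y \<in> {a..b}; norm (y - x) < d x\<rbrakk>
          \<Longrightarrow> norm (F y - F x - (y - x) *\<^sub>R g x) \<le> e' * norm (y - x)"
      by metis
    obtain \<delta> where \<delta>: "\<delta> > 0"
      "\<And>\<D> T. \<D> division_of T \<Longrightarrow> T \<subseteq> {a..b} \<Longrightarrow> (\<Sum>K\<in>\<D>. Sup K - Inf K) < \<delta> \<Longrightarrow>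
          (\<Sum>K\<in>\<D>. norm (F (Sup K) - F (Inf K))) < e / 2"
      using abs_continuous_onE[OF F half_gt_zero[OF \<open>e > 0\<close>]] by metis
    have Nnull: "N \<in> null_sets lebesgue"
      using N negligible_iff_null_sets by blast
    then obtain U where U: "open U" "N \<subseteq> U" "U - N \<in> lmeasurable"
        "emeasure lebesgue (U - N) < ennreal \<delta>"
      using sets_lebesgue_outer_open[OF null_setsD2 \<delta>(1)] by blast
    have Umeas: "U \<in> lmeasurable" "measure lebesgue U < \<delta>"
    proof -
      have em: "emeasure lebesgue U = emeasure lebesgue (U - N)"
        using Nnull U(1) by (simp add: emeasure_Diff_null_set)
      then show "U \<in> lmeasurable"
        using U(1,4) by (auto simp: fmeasurable_def intro: less_trans)
      show "measure lebesgue U < \<delta>"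
        using em U(4) \<delta>(1) by (metis emeasure_eq_ennreal_measure ennreal_less_iff
            less_imp_neq measure_nonneg order_less_trans ennreal_less_top)
    qed
    define \<gamma> where "\<gamma> x = (if x \<in> N then U else ball x (d x))" for x
    show "\<exists>\<gamma>. gauge \<gamma> \<and> (\<forall>\<D>. \<D> tagged_division_of cbox a b \<and> \<gamma> fine \<D> \<longrightarrow>
        norm ((\<Sum>(x,K)\<in>\<D>. measure lborel K *\<^sub>R g0 x) - (F b - F a)) < e)"
    proof (intro exI[of _ \<gamma>] conjI allI impI)
      show "gauge \<gamma>"
        using U(1,2) d(1) by (auto simp: gauge_def \<gamma>_def)
      fix \<D> assume "\<D> tagged_division_of cbox a b \<and> \<gamma> fine \<D>"
      then have tag: "\<D> tagged_division_of {a..b}" and fine: "\<gamma> fine \<D>" by auto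
      define \<D>N where "\<D>N = {p \<in> \<D>. fst p \<in> N}"
      have fin: "finite \<D>" using tag by blast
      have shape: "\<exists>u v. K = {u..v} \<and> u \<le> v \<and> x \<in> K \<and> K \<subseteq> {a..b} \<and> K \<subseteq> \<gamma> x"
        if "(x, K) \<in> \<D>" for x K
        using tagged_division_ofD(2,3,4)[OF tag that] fineD[OF fine that] by fastforce
      have DN: "\<D>N tagged_division_of \<Union>(snd ` \<D>N)"
      proof (rule tagged_partial_division_of_Union_self[OF tagged_partial_division_subset])
        show "\<D> tagged_partial_division_of {a..b}"
          using tag by (simp add: tagged_division_of_def)
        show "\<D>N \<subseteq> \<D>"
          unfolding \<D>N_def by (rule Collect_subset)
      qed
      then have div: "snd ` \<D>N division_of \<Union>(snd ` \<D>N)"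
        by (rule division_of_tagged_division)
      have shapeN: "\<exists>u v. K = {u..v} \<and> u \<le> v \<and> K \<subseteq> {a..b} \<and> K \<subseteq> U" if K: "K \<in> snd ` \<D>N" for K
      proof -
        obtain x where x: "(x, K) \<in> \<D>" "x \<in> N"
          using K by (auto simp: \<D>N_def)
        then have "\<gamma> x = U" by (simp add: \<gamma>_def)
        then show ?thesis
          using shape[OF x(1)] by metis
      qed
      have inside: "\<Union>(snd ` \<D>N) \<subseteq> {a..b}" "\<Union>(snd ` \<D>N) \<subseteq> U"
        using shapeN by blast+
      \<comment> \<open>The intervals with tag in \<open>N\<close> do not overlap and lie in \<open>U\<close>, so their total length is below \<open>\<delta>\<close>.\<close>
      have "(\<Sum>K\<in>snd ` \<D>N. Sup K - Inf K) = (\<Sum>K\<in>snd ` \<D>N. measure lebesgue K)"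
        by (rule sum.cong) (auto dest!: shapeN)
      also have "\<dots> = measure lebesgue (\<Union>(snd ` \<D>N))"
        by (rule content_division[OF div])
      also have "\<dots> \<le> measure lebesgue U"
        using inside(2) Umeas(1) lmeasurable_division[OF div]
        by (intro measure_mono_fmeasurable) auto
      finally have "(\<Sum>K\<in>snd ` \<D>N. norm (F (Sup K) - F (Inf K))) < e / 2"
        using \<delta>(2)[OF div inside(1)] Umeas(2) by linarith
      moreover have "(\<Sum>(x,K)\<in>\<D>N. norm (F (Sup K) - F (Inf K)))
          = (\<Sum>K\<in>snd ` \<D>N. norm (F (Sup K) - F (Inf K)))"
      proof -
        \<comment> \<open>Two tags can share an interval only if it is degenerate, and then its increment vanishes.
          The empty interval, where \<open>Sup\<close> and \<open>Inf\<close> have no useful value, is sent to \<open>0\<close>.\<close>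
        define \<phi> where "\<phi> K = (if K = {} then 0 else norm (F (Sup K) - F (Inf K)))" for K
        have ne: "K \<noteq> {}" if "(x, K) \<in> \<D>N" for x K
          using shape[of x K] that by (auto simp: \<D>N_def)
        have "(\<Sum>(x,K)\<in>\<D>N. \<phi> K) = (\<Sum>K\<in>snd ` \<D>N. \<phi> K)"
        proof (rule sum.over_tagged_division_lemma[OF DN])
          fix u v :: real assume "box u v = {}"
          then have "v \<le> u" by simp
          then show "\<phi> (cbox u v) = 0"
            by (cases "u = v") (auto simp: \<phi>_def)
        qed
        moreover have "(\<Sum>(x,K)\<in>\<D>N. \<phi> K) = (\<Sum>(x,K)\<in>\<D>N. norm (F (Sup K) - F (Inf K)))"
          by (rule sum.cong) (use ne in \<open>auto simp: \<phi>_def\<close>)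
        moreover have "(\<Sum>K\<in>snd ` \<D>N. \<phi> K) = (\<Sum>K\<in>snd ` \<D>N. norm (F (Sup K) - F (Inf K)))"
          by (rule sum.cong) (use ne in \<open>auto simp: \<phi>_def\<close>)
        ultimately show ?thesis by simp
      qed
      ultimately have bad: "(\<Sum>(x,K)\<in>\<D>N. norm (F (Sup K) - F (Inf K))) < e / 2" by simp
      have piece: "norm (measure lborel K *\<^sub>R g0 x - (F (Sup K) - F (Inf K)))
          \<le> e' * (Sup K - Inf K) + (if x \<in> N then norm (F (Sup K) - F (Inf K)) else 0)"
        if xK: "(x, K) \<in> \<D>" for x K
      proof -
        obtain u v where uv: "K = {u..v}" "u \<le> v" "x \<in> K" "K \<subseteq> {a..b}" "K \<subseteq> \<gamma> x"
          using shape[OF xK] by blast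
        show ?thesis
        proof (cases "x \<in> N")
          case True
          then show ?thesis
            using e'(1) uv by (simp add: g0_def norm_minus_commute)
        next
          case False
          have dx: "norm (F y - F x - (y - x) *\<^sub>R g x) \<le> e' * norm (y - x)" if "y \<in> K" for y
            using d(2)[of x y] False uv that
            by (force simp: \<gamma>_def dist_norm norm_minus_commute)
          have "norm ((v - u) *\<^sub>R g x - (F v - F u))
              = norm ((F u - F x - (u - x) *\<^sub>R g x) - (F v - F x - (v - x) *\<^sub>R g x))"
            by (simp add: algebra_simps)
          also have "\<dots> \<le> norm (F u - F x - (u - x) *\<^sub>R g x) + norm (F v - F x - (v - x) *\<^sub>R g x)"
            by (rule norm_triangle_ineq4)
          also have "\<dots> \<le> e' * norm (u - x) + e' * norm (v - x)"
            using uv by (intro add_mono dx) auto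
          also have "\<dots> = e' * (v - u)"
            using uv by (auto simp: algebra_simps)
          finally show ?thesis
            using False uv by (simp add: g0_def)
        qed
      qed
      have "(\<Sum>(x,K)\<in>\<D>. measure lborel K *\<^sub>R g0 x) - (F b - F a)
          = (\<Sum>p\<in>\<D>. case p of (x,K) \<Rightarrow> measure lborel K *\<^sub>R g0 x - (F (Sup K) - F (Inf K)))"
        using additive_tagged_division_1[OF \<open>a \<le> b\<close> tag, of F]
        by (simp add: sum_subtractf split_def)
      also have "norm \<dots> \<le> (\<Sum>p\<in>\<D>. case p of (x,K) \<Rightarrow>
          e' * (Sup K - Inf K) + (if x \<in> N then norm (F (Sup K) - F (Inf K)) else 0))"
        using piece by (intro sum_norm_le) auto
      also have "\<dots> = e' * (\<Sum>(x,K)\<in>\<D>. Sup K - Inf K)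
          + (\<Sum>p\<in>\<D>. if fst p \<in> N then norm (F (Sup (snd p)) - F (Inf (snd p))) else 0)"
        by (simp add: split_def sum.distrib sum_distrib_left)
      also have "(\<Sum>(x,K)\<in>\<D>. Sup K - Inf K) = b - a"
        using additive_tagged_division_1[OF \<open>a \<le> b\<close> tag, of "\<lambda>t. t"] by simp
      also have "(\<Sum>p\<in>\<D>. if fst p \<in> N then norm (F (Sup (snd p)) - F (Inf (snd p))) else 0)
          = (\<Sum>(x,K)\<in>\<D>N. norm (F (Sup K) - F (Inf K)))"
        using fin by (simp add: \<D>N_def sum.inter_filter split_def)
      also have "e' * (b - a) + \<dots> < e"
        using e'(2) bad by linarith
      finally show "norm ((\<Sum>(x,K)\<in>\<D>. measure lborel K *\<^sub>R g0 x) - (F b - F a)) < e" .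
    qed
  qed
  then show ?thesis
    using N by (auto intro: has_integral_spike[of N _ g g0] simp: g0_def)
qed

section \<open>Green's formula for arcs\<close>

lemma AE_in_lebesgue_negligible:
  assumes "AE t\<in>S in lebesgue. P t"
  shows "\<exists>N. negligible N \<and> (\<forall>t\<in>S - N. P t)"
proof -
  obtain N where "N \<in> null_sets lebesgue" "{t. \<not> (t \<in> S \<longrightarrow> P t)} \<subseteq> N"
    using assms by (auto simp: eventually_ae_filter)
  then show ?thesis
    using negligible_iff_null_sets by blast
qed

lemma has_vector_derivative_ddt:
  "x differentiable (at t within {0..1}) \<Longrightarrow> (x has_vector_derivative ddt x t) (at t within {0..1})"
  unfolding ddt_def by (simp add: vector_derivative_works)

lemma ac_arc_has_vector_derivative_ae:
  assumes "ac_arc x"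
  shows "\<exists>N. negligible N \<and>
    (\<forall>t\<in>{0..1} - N. (x has_vector_derivative ddt x t) (at t within {0..1}))"
  using assms AE_in_lebesgue_negligible has_vector_derivative_ddt
  unfolding ac_arc_def by metis

lemma ac2_arcD:
  assumes "ac2_arc x"
  shows "abs_continuous_on {0..1} x" "abs_continuous_on {0..1} (ddt x)" "ac_arc (ddt x)"
    "\<And>t. t \<in> {0..1} \<Longrightarrow> (x has_vector_derivative ddt x t) (at t within {0..1})"
  using assms by (auto simp: ac2_arc_def ac_arc_def has_vector_derivative_ddt)

text \<open>
  The boundary form that Lagrange's identity attaches to the adjoint pair \<open>(p, \<psi>)\<close>.
\<close>

definition concomitant ::
    "(real \<Rightarrow> 'a::euclidean_space) \<Rightarrow> (real \<Rightarrow> 'a) \<Rightarrow> (real \<Rightarrow> 'a) \<Rightarrow> real \<Rightarrow> real" where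
  "concomitant p \<psi> x t = ddt p t \<bullet> x t - p t \<bullet> ddt x t + \<psi> t \<bullet> x t"

text \<open>
  Integration by parts carried out twice: the integrand is the derivative of the concomitant almost
  everywhere, because the two products \<open>p' \<bullet> x'\<close> cancel. The concomitant is absolutely continuous, so
  its increment is the integral of this derivative.
\<close>

lemma green_formula:
  fixes p \<psi> x :: "real \<Rightarrow> 'a::euclidean_space"
  assumes p: "ac2_arc p" and \<psi>: "ac_arc \<psi>" and x: "ac2_arc x"
  shows "((\<lambda>t. (ddt (ddt p) t + ddt \<psi> t, \<psi> t, - p t) \<bullet> (x t, ddt x t, ddt (ddt x) t))
    has_integral (concomitant p \<psi> x 1 - concomitant p \<psi> x 0)) {0..1}"
proof -
  note p' = ac2_arcD[OF p] and x' = ac2_arcD[OF x]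
  obtain Np where Np: "negligible Np"
    "\<And>t. t \<in> {0..1} - Np \<Longrightarrow> (ddt p has_vector_derivative ddt (ddt p) t) (at t within {0..1})"
    using ac_arc_has_vector_derivative_ae[OF p'(3)] by blast
  obtain Nx where Nx: "negligible Nx"
    "\<And>t. t \<in> {0..1} - Nx \<Longrightarrow> (ddt x has_vector_derivative ddt (ddt x) t) (at t within {0..1})"
    using ac_arc_has_vector_derivative_ae[OF x'(3)] by blast
  obtain N\<psi> where N\<psi>: "negligible N\<psi>"
    "\<And>t. t \<in> {0..1} - N\<psi> \<Longrightarrow> (\<psi> has_vector_derivative ddt \<psi> t) (at t within {0..1})"
    using ac_arc_has_vector_derivative_ae[OF \<psi>] by blast
  show ?thesis
  proof (rule fundamental_theorem_of_calculus_abs_continuous)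
    show "abs_continuous_on {0..1} (concomitant p \<psi> x)"
      unfolding concomitant_def using p' x' \<psi>
      by (intro abs_continuous_on_add abs_continuous_on_diff abs_continuous_on_inner)
        (auto simp: ac_arc_def)
    show "negligible (Np \<union> Nx \<union> N\<psi>)"
      using Np Nx N\<psi> by auto
    fix t :: real assume t: "t \<in> {0..1} - (Np \<union> Nx \<union> N\<psi>)"
    have "(concomitant p \<psi> x has_vector_derivative
        (ddt p t \<bullet> ddt x t + ddt (ddt p) t \<bullet> x t) - (p t \<bullet> ddt (ddt x) t + ddt p t \<bullet> ddt x t)
        + (\<psi> t \<bullet> ddt x t + ddt \<psi> t \<bullet> x t)) (at t within {0..1})"
      unfolding concomitant_def using t p'(4) x'(4) Np(2) Nx(2) N\<psi>(2)
      by (intro has_vector_derivative_add has_vector_derivative_diff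
          bounded_bilinear.has_vector_derivative[OF bounded_bilinear_inner]) auto
    then show "(concomitant p \<psi> x has_vector_derivative
        (ddt (ddt p) t + ddt \<psi> t, \<psi> t, - p t) \<bullet> (x t, ddt x t, ddt (ddt x) t)) (at t within {0..1})"
      by (simp add: inner_add_left algebra_simps)
  qed simp
qed

section \<open>Convex inequalities\<close>

text \<open>
  Along the segment from \<open>z\<close> to \<open>y\<close> this is the tangent inequality for convex functions of one
  variable.
\<close>

lemma convex_on_imp_above_gradient:
  fixes g :: "'a::real_inner \<Rightarrow> real"
  assumes convex: "convex_on UNIV g" and grad: "GDERIV g z :> D"
  shows "g z + D \<bullet> (y - z) \<le> g y"
proof -
  define \<phi> where "\<phi> s = g (z + s *\<^sub>R (y - z))" for s :: real
  have "convex_on UNIV \<phi>"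
  proof (rule convex_onI)
    fix s r r' :: real assume s: "0 < s" "s < 1"
    have "\<phi> ((1 - s) *\<^sub>R r + s *\<^sub>R r')
        = g ((1 - s) *\<^sub>R (z + r *\<^sub>R (y - z)) + s *\<^sub>R (z + r' *\<^sub>R (y - z)))"
      by (simp add: \<phi>_def algebra_simps)
    also have "\<dots> \<le> (1 - s) * \<phi> r + s * \<phi> r'"
      unfolding \<phi>_def using convex s by (intro convex_onD) auto
    finally show "\<phi> ((1 - s) *\<^sub>R r + s *\<^sub>R r') \<le> (1 - s) * \<phi> r + s * \<phi> r'" .
  qed simp
  moreover have "(\<phi> has_real_derivative D \<bullet> (y - z)) (at 0)"
  proof -
    have "((\<lambda>s. z + s *\<^sub>R (y - z)) has_derivative (\<lambda>s. s *\<^sub>R (y - z))) (at (0::real))"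
      by (auto intro!: derivative_eq_intros)
    moreover have "(g has_derivative (\<lambda>h. h \<bullet> D)) (at (z + 0 *\<^sub>R (y - z)))"
      using grad by (simp add: gderiv_def)
    ultimately have "(\<phi> has_derivative (\<lambda>s. (s *\<^sub>R (y - z)) \<bullet> D)) (at 0)"
      unfolding \<phi>_def by (rule has_derivative_compose)
    moreover have "(\<lambda>s. (s *\<^sub>R (y - z)) \<bullet> D) = (*) (D \<bullet> (y - z))"
      by (auto simp: inner_commute)
    ultimately show ?thesis
      unfolding has_field_derivative_def by simp
  qed
  ultimately have "\<phi> 1 - \<phi> 0 \<ge> D \<bullet> (y - z) * (1 - 0)"
    by (intro convex_on_imp_above_tangent[where A = UNIV]) auto
  then show ?thesis by (simp add: \<phi>_def)
qed

text \<open>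
  Each subgradient of \<open>W k\<close> at \<open>z\<close>, paired with \<open>z' - z\<close>, is at most the increment of \<open>W k\<close>, which is
  nonpositive. The members of \<open>A\<close> will be the active constraints, with \<open>z'\<close> taken from a competing arc.
\<close>

lemma weighted_subgradients_inner_le_0:
  assumes "finite A"
    and \<xi>: "\<xi> \<in> (\<Sum>k\<in>A. (*\<^sub>R) (\<alpha> k) ` subdifferential (W k) z)"
    and \<alpha>: "\<And>k. k \<in> A \<Longrightarrow> \<alpha> k \<ge> 0"
    and W: "\<And>k. k \<in> A \<Longrightarrow> W k z' \<le> W k z"
  shows "\<xi> \<bullet> (z' - z) \<le> 0"
proof -
  obtain s where s: "\<xi> = sum s A"
    "\<And>k. k \<in> A \<Longrightarrow> s k \<in> (*\<^sub>R) (\<alpha> k) ` subdifferential (W k) z"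
    using \<xi> unfolding set_sum_alt[OF \<open>finite A\<close>] by auto
  have "s k \<bullet> (z' - z) \<le> 0" if k: "k \<in> A" for k
  proof -
    obtain \<eta> where "s k = \<alpha> k *\<^sub>R \<eta>" "\<eta> \<in> subdifferential (W k) z"
      using s(2)[OF k] by auto
    moreover from this have "W k z + \<eta> \<bullet> (z' - z) \<le> W k z'"
      by (simp add: subdifferential_def)
    then have "\<eta> \<bullet> (z' - z) \<le> 0"
      using W[OF k] by simp
    ultimately show ?thesis
      using \<alpha>[OF k] by (simp add: mult_nonneg_nonpos)
  qed
  then show ?thesis
    by (simp add: s(1) inner_sum_left sum_nonpos)
qed

section \<open>Sufficiency of the adjoint inclusion\<close>

theorem theorem5p1:
  fixes f :: "real^'n \<Rightarrow> real \<Rightarrow> real"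
    and f\<^sub>x :: "real^'n \<Rightarrow> real \<Rightarrow> real^'n"
    and q :: "real^'n \<Rightarrow> real"
    and W :: "nat \<Rightarrow> (real^'n) \<times> (real^'n) \<times> (real^'n) \<Rightarrow> real"
    and m :: nat
    and \<upsilon>0 \<upsilon>1 :: "real^'n"
    and x :: "real \<Rightarrow> real^'n"
  assumes f_gradient: "\<And>z t. t \<in> {0..1} \<Longrightarrow> GDERIV (\<lambda>y. f y t) z :> f\<^sub>x z t"
    and f_C1: "\<And>t. t \<in> {0..1} \<Longrightarrow> continuous_on UNIV (\<lambda>z. f\<^sub>x z t)"
    and f_convex: "\<And>t. t \<in> {0..1} \<Longrightarrow> convex_on UNIV (\<lambda>z. f z t)"
    and objective_defined: "\<And>y. feasible_arc W m \<upsilon>0 \<upsilon>1 y \<Longrightarrow> (\<lambda>t. f (y t) t) absolutely_integrable_on {0..1}"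
    and W_continuous: "\<And>k. k \<in> {1..m} \<Longrightarrow> continuous_on UNIV (W k)"
    and W_convex: "\<And>k. k \<in> {1..m} \<Longrightarrow> convex_on UNIV (W k)"
    and q_continuous: "continuous_on UNIV q"
    and q_convex: "convex_on UNIV q"
    and x_feasible: "feasible_arc W m \<upsilon>0 \<upsilon>1 x"
    and adjoint: "\<exists>(xadj :: real \<Rightarrow> real^'n) (\<psi>adj :: real \<Rightarrow> real^'n) (\<alpha> :: nat \<Rightarrow> real \<Rightarrow> real).
       ac2_arc xadj \<and> ac_arc \<psi>adj \<and>
       (AE t\<in>{0..1} in lebesgue.
          (ddt (ddt xadj) t + ddt \<psi>adj t - f\<^sub>x (x t) t, \<psi>adj t, - xadj t)
            \<in> (\<Sum>k\<in>active_set W m (x t, ddt x t, ddt (ddt x) t).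
                  (*\<^sub>R) (\<alpha> k t) ` subdifferential (W k) (x t, ddt x t, ddt (ddt x) t))) \<and>
       (AE t\<in>{0..1} in lebesgue. \<forall>k\<in>active_set W m (x t, ddt x t, ddt (ddt x) t).
          \<alpha> k t * W k (x t, ddt x t, ddt (ddt x) t) = 0 \<and> \<alpha> k t \<ge> 0) \<and>
       - \<psi>adj 1 - ddt xadj 1 \<in> subdifferential q (x 1) \<and> xadj 1 = 0"
  shows "optimal_arc f q W m \<upsilon>0 \<upsilon>1 x"
  unfolding optimal_arc_def
proof (intro conjI allI impI)
  show "feasible_arc W m \<upsilon>0 \<upsilon>1 x" by fact
  fix y assume y_feasible: "feasible_arc W m \<upsilon>0 \<upsilon>1 y"
  obtain p \<psi> :: "real \<Rightarrow> real^'n" and \<alpha> where p: "ac2_arc p" and \<psi>: "ac_arc \<psi>"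
    and inclusion: "AE t\<in>{0..1} in lebesgue.
          (ddt (ddt p) t + ddt \<psi> t - f\<^sub>x (x t) t, \<psi> t, - p t)
            \<in> (\<Sum>k\<in>active_set W m (x t, ddt x t, ddt (ddt x) t).
                  (*\<^sub>R) (\<alpha> k t) ` subdifferential (W k) (x t, ddt x t, ddt (ddt x) t))"
    and multipliers: "AE t\<in>{0..1} in lebesgue. \<forall>k\<in>active_set W m (x t, ddt x t, ddt (ddt x) t).
          \<alpha> k t * W k (x t, ddt x t, ddt (ddt x) t) = 0 \<and> \<alpha> k t \<ge> 0"
    and transversality: "- \<psi> 1 - ddt p 1 \<in> subdifferential q (x 1)" "p 1 = 0"
    using adjoint by blast
  have x: "ac2_arc x" "x 0 = \<upsilon>0" "ddt x 0 = \<upsilon>1" and y: "ac2_arc y" "y 0 = \<upsilon>0" "ddt y 0 = \<upsilon>1"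
    using x_feasible y_feasible by (auto simp: feasible_arc_def)
  have y_constraints: "AE t\<in>{0..1} in lebesgue. \<forall>k\<in>{1..m}. W k (y t, ddt y t, ddt (ddt y) t) \<le> 0"
    using y_feasible by (simp add: feasible_arc_def)
  define G where "G u t = (ddt (ddt p) t + ddt \<psi> t, \<psi> t, - p t) \<bullet> (u t, ddt u t, ddt (ddt u) t)" for u t
  \<comment> \<open>Stationarity at \<open>x\<close> bounds the difference of the two Green integrands by that of the running costs.\<close>
  have "AE t\<in>{0..1} in lebesgue. G y t - G x t \<le> f (y t) t - f (x t) t"
    using inclusion multipliers y_constraints
  proof eventually_elim
    case (elim t)
    show ?case
    proof
      assume t: "t \<in> {0..1}"
      define A where "A = active_set W m (x t, ddt x t, ddt (ddt x) t)"
      have "(ddt (ddt p) t + ddt \<psi> t - f\<^sub>x (x t) t, \<psi> t, - p t) \<bullet>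
          ((y t, ddt y t, ddt (ddt y) t) - (x t, ddt x t, ddt (ddt x) t)) \<le> 0"
      proof (rule weighted_subgradients_inner_le_0[where A = A and W = W and \<alpha> = "\<lambda>k. \<alpha> k t"])
        show "finite A" by (simp add: A_def active_set_def)
      qed (use elim t in \<open>auto simp: A_def active_set_def\<close>)
      then have "G y t - G x t \<le> f\<^sub>x (x t) t \<bullet> (y t - x t)"
        by (simp add: G_def inner_diff_left inner_diff_right inner_add_left)
      also have "\<dots> \<le> f (y t) t - f (x t) t"
        using convex_on_imp_above_gradient[OF f_convex f_gradient, OF t t, of "x t" "y t"] by simp
      finally show "G y t - G x t \<le> f (y t) t - f (x t) t" .
    qed
  qed
  from AE_in_lebesgue_negligible[OF this] obtain N where N: "negligible N"
    "\<And>t. t \<in> {0..1} - N \<Longrightarrow> G y t - G x t \<le> f (y t) t - f (x t) t"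
    by blast
  have f_integral: "((\<lambda>t. f (u t) t) has_integral (LINT t:{0..1}|lebesgue. f (u t) t)) {0..1}"
    if "feasible_arc W m \<upsilon>0 \<upsilon>1 u" for u
    by (rule has_integral_set_lebesgue[OF objective_defined[OF that]])
  have "(concomitant p \<psi> y 1 - concomitant p \<psi> y 0) - (concomitant p \<psi> x 1 - concomitant p \<psi> x 0)
      \<le> (LINT t:{0..1}|lebesgue. f (y t) t) - (LINT t:{0..1}|lebesgue. f (x t) t)"
    \<comment> \<open>On the null set \<open>N\<close> the integrand is altered so that the comparison holds at every time.\<close>
  proof (rule has_integral_le)
    have G: "((\<lambda>t. G y t - G x t) has_integral
        (concomitant p \<psi> y 1 - concomitant p \<psi> y 0) - (concomitant p \<psi> x 1 - concomitant p \<psi> x 0)) {0..1}"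
      unfolding G_def by (intro has_integral_diff green_formula p \<psi> x y)
    show "((\<lambda>t. if t \<in> N then f (y t) t - f (x t) t else G y t - G x t) has_integral
        (concomitant p \<psi> y 1 - concomitant p \<psi> y 0) - (concomitant p \<psi> x 1 - concomitant p \<psi> x 0)) {0..1}"
      by (rule has_integral_spike[OF N(1) _ G]) simp
    show "((\<lambda>t. f (y t) t - f (x t) t) has_integral
        (LINT t:{0..1}|lebesgue. f (y t) t) - (LINT t:{0..1}|lebesgue. f (x t) t)) {0..1}"
      by (intro has_integral_diff f_integral x_feasible y_feasible)
  qed (use N in auto)
  \<comment> \<open>The initial conditions cancel the terms at \<open>0\<close>, and \<open>p 1 = 0\<close> removes the velocities at \<open>1\<close>.\<close>
  moreover have "(concomitant p \<psi> y 1 - concomitant p \<psi> y 0) - (concomitant p \<psi> x 1 - concomitant p \<psi> x 0)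
      = (ddt p 1 + \<psi> 1) \<bullet> (y 1 - x 1)"
    using transversality(2) x y by (simp add: concomitant_def inner_add_left inner_diff_right)
  moreover have "q (x 1) - (ddt p 1 + \<psi> 1) \<bullet> (y 1 - x 1) \<le> q (y 1)"
  proof -
    have "q (x 1) + (- \<psi> 1 - ddt p 1) \<bullet> (y 1 - x 1) \<le> q (y 1)"
      using transversality(1) by (auto simp: subdifferential_def)
    moreover have "- \<psi> 1 - ddt p 1 = - (ddt p 1 + \<psi> 1)" by simp
    ultimately show ?thesis by (simp only: inner_minus_left)
  qed
  ultimately show "objective f q x \<le> objective f q y"
    unfolding objective_def by linarith
qed

end
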